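(* Let $k\in\mathbb{N}\setminus\{0\}$. Any lattice $\mathcal{L}$ of regular subsets of $\mathbb{N}$ which is closed under decrement is also closed under $k$-root; that is, $L\in\mathcal{L}$ implies $\sqrt[k]{L}=\{x\in\mathbb{N}\mid x^k\in L\}\in\mathcal{L}$.
   Context: $\mathbb{N}=\{0,1,2,\ldots\}$. A lattice over a set $X$ is any non empty family of subsets of $X$ closed under (binary) union and intersection. For $L\subseteq\mathbb{N}$ and $i\in\mathbb{N}$, $L-i=\{x\in\mathbb{N}\mid x+i\in L\}$; a family $\mathcal{L}$ of subsets of $\mathbb{N}$ is closed under decrement if $L\in\mathcal{L}$ implies $L-1\in\mathcal{L}$. A subset of $\mathbb{N}$ is regular if it is recognized by a finite automaton in unary notation; equivalently, if it is the union of a finite set with finitely many arithmetic progressions $a+r\mathbb{N}$ ($a,r\in\mathbb{N}$, $r\geq1$). *)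

theory Defs
  imports Main
begin

definition lattice_over :: "'a set \<Rightarrow> 'a set set \<Rightarrow> bool" where
  "lattice_over X \<L> \<longleftrightarrow>
     \<L> \<noteq> {} \<and> \<L> \<subseteq> Pow X \<and>
     (\<forall>A\<in>\<L>. \<forall>B\<in>\<L>. A \<union> B \<in> \<L> \<and> A \<inter> B \<in> \<L>)"

text \<open>
  The unary notation of n is the word of length n over a one-letter alphabet, so the transition
  function of a (complete, deterministic) automaton is a self-map \<open>\<delta>\<close> of the state set \<open>Q\<close>,
  and the state reached on input n is \<open>(\<delta> ^^ n) q\<^sub>0\<close>. Taking the states to be natural numbers
  loses no generality, since \<open>Q\<close> is finite.
\<close>

definition regular :: "nat set \<Rightarrow> bool" where
  "regular L \<longleftrightarrow>
     (\<exists>(Q :: nat set) (\<delta> :: nat \<Rightarrow> nat) q\<^sub>0 F.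
        finite Q \<and> q\<^sub>0 \<in> Q \<and> F \<subseteq> Q \<and> \<delta> ` Q \<subseteq> Q \<and>
        L = {n. (\<delta> ^^ n) q\<^sub>0 \<in> F})"

definition decrement :: "nat set \<Rightarrow> nat \<Rightarrow> nat set" where
  "decrement L i = {x. x + i \<in> L}"

definition closed_under_decrement :: "nat set set \<Rightarrow> bool" where
  "closed_under_decrement \<L> \<longleftrightarrow> (\<forall>L\<in>\<L>. decrement L 1 \<in> \<L>)"

definition kroot :: "nat \<Rightarrow> nat set \<Rightarrow> nat set" where
  "kroot k L = {x. x ^ k \<in> L}"

end

theory Submission
  imports Defs
begin

text \<open>
  Write \<open>f x = x ^ k\<close>. Then \<open>f x \<ge> x\<close>, and for \<open>x \<le> y\<close> the number \<open>f y - f x\<close> is a nonnegative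
  multiple of \<open>y - x\<close>. If \<open>x\<close> lies in every decrement of \<open>L\<close> that contains \<open>a\<close>, then shifting by
  \<open>x - a\<close> keeps the elements of \<open>L\<close> above \<open>a\<close> inside \<open>L\<close>, and repeating this shift leads from
  \<open>f a\<close> to \<open>f x\<close>. Hence the preimage of \<open>L\<close> under \<open>f\<close> is the union, over its elements \<open>a\<close>, of the
  intersections of all decrements of \<open>L\<close> containing \<open>a\<close>. A regular set has only finitely many
  decrements, so this is a finite lattice combination, except that the union may be empty; but then
  the empty set is the intersection of all decrements of \<open>L\<close>.
\<close>

lemma decrement_0 [simp]: "decrement L 0 = L"
  by (simp add: decrement_def)

lemma decrement_decrement: "decrement (decrement L i) j = decrement L (i + j)"
  by (auto simp: decrement_def ac_simps)

lemma mem_decrement: "x \<in> decrement L i \<longleftrightarrow> x + i \<in> L"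
  by (simp add: decrement_def)

lemma closed_under_decrementD:
  assumes "closed_under_decrement \<L>" "L \<in> \<L>"
  shows "decrement L i \<in> \<L>"
proof (induction i)
  case 0
  then show ?case using assms by simp
next
  case (Suc i)
  then have "decrement (decrement L i) 1 \<in> \<L>"
    using assms(1) unfolding closed_under_decrement_def by blast
  then show ?case by (simp add: decrement_decrement)
qed

lemma lattice_over_Inter:
  assumes "lattice_over X \<L>" "finite \<A>" "\<A> \<noteq> {}" "\<A> \<subseteq> \<L>"
  shows "\<Inter>\<A> \<in> \<L>"
  using assms(2-4)
  by (induction rule: finite_ne_induct) (use assms(1) in \<open>auto simp: lattice_over_def\<close>)

lemma lattice_over_Union:
  assumes "lattice_over X \<L>" "finite \<A>" "\<A> \<noteq> {}" "\<A> \<subseteq> \<L>"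
  shows "\<Union>\<A> \<in> \<L>"
  using assms(2-4)
  by (induction rule: finite_ne_induct) (use assms(1) in \<open>auto simp: lattice_over_def\<close>)

text \<open>Moving the initial state \<open>q\<close> to \<open>(\<delta> ^^ i) q\<close> turns an
  automaton for \<open>L\<close> into one for \<open>decrement L i\<close>, so there are at most as
  many decrements as states.\<close>

lemma regular_finite_decrements:
  assumes "regular L"
  shows "finite (range (decrement L))"
proof -
  obtain Q :: "nat set" and \<delta> q F
    where Q: "finite Q" "q \<in> Q" "\<delta> ` Q \<subseteq> Q" and L: "L = {n. (\<delta> ^^ n) q \<in> F}"
    using assms unfolding regular_def by blast
  have "(\<delta> ^^ i) q \<in> Q" for i
    using Q by (induction i) auto
  moreover have "decrement L i = {n. (\<delta> ^^ n) ((\<delta> ^^ i) q) \<in> F}" for i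
    by (simp add: decrement_def L funpow_add)
  ultimately have "range (decrement L) \<subseteq> (\<lambda>p. {n. (\<delta> ^^ n) p \<in> F}) ` Q"
    by blast
  then show ?thesis
    using Q(1) finite_surj by blast
qed

lemma mem_add_mult:
  fixes a d i m :: nat
  assumes "\<And>i. a + i \<in> L \<Longrightarrow> a + d + i \<in> L" "a + i \<in> L"
  shows "a + i + m * d \<in> L"
proof (induction m)
  case (Suc m)
  then show ?case
    using assms(1)[of "i + m * d"] by (simp add: ac_simps)
qed (use assms(2) in simp)

lemma mem_remove_mult:
  fixes x d i m :: nat
  assumes "\<And>i. x + d + i \<in> L \<Longrightarrow> x + i \<in> L" "x + i + m * d \<in> L"
  shows "x + i \<in> L"
  using assms(2)
proof (induction m)
  case (Suc m)
  then show ?case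
    using assms(1)[of "i + m * d"] by (simp add: ac_simps)
qed simp

text \<open>\<open>shift\<close> translates by \<open>x - a\<close>, but only points at or above
  \<open>a\<close>. Going up from \<open>f a\<close> stays in that range; going down, every point
  before \<open>f x\<close> is at least \<open>x + d = a\<close>, since
  \<open>x \<le> f x\<close>.\<close>

lemma vimage_mem_transfer:
  fixes f :: "nat \<Rightarrow> nat"
  assumes le: "\<And>x. x \<le> f x"
    and incr: "\<And>x d. \<exists>m. f (x + d) = f x + m * d"
    and shift: "\<And>i. a + i \<in> L \<Longrightarrow> x + i \<in> L"
    and "f a \<in> L"
  shows "f x \<in> L"
proof (cases "a \<le> x")
  case True
  then obtain d where x: "x = a + d" using le_Suc_ex by blast
  obtain m where m: "f x = f a + m * d" using incr x by blast
  obtain i where i: "f a = a + i" using le le_Suc_ex by blast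
  have "a + i + m * d \<in> L"
    by (rule mem_add_mult) (use shift x i \<open>f a \<in> L\<close> in auto)
  then show ?thesis by (simp add: m i)
next
  case False
  then obtain d where a: "a = x + d" using le_Suc_ex nat_le_linear by blast
  obtain m where m: "f a = f x + m * d" using incr a by blast
  obtain i where i: "f x = x + i" using le le_Suc_ex by blast
  have "x + i \<in> L"
    by (rule mem_remove_mult[where d = d and m = m]) (use shift a i m \<open>f a \<in> L\<close> in auto)
  then show ?thesis by (simp add: i)
qed

lemma lattice_closed_vimage:
  fixes f :: "nat \<Rightarrow> nat"
  assumes le: "\<And>x. x \<le> f x"
    and incr: "\<And>x d. \<exists>m. f (x + d) = f x + m * d"
    and lat: "lattice_over X \<L>"
    and decr: "closed_under_decrement \<L>"
    and "L \<in> \<L>" "regular L"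
  shows "f -` L \<in> \<L>"
proof -
  let ?D = "range (decrement L)"
  have fin: "finite ?D" using \<open>regular L\<close> by (rule regular_finite_decrements)
  have D: "?D \<subseteq> \<L>" using closed_under_decrementD[OF decr \<open>L \<in> \<L>\<close>] by blast
  define C where "C a = \<Inter>{A \<in> ?D. a \<in> A}" for a
  have mem_C: "x \<in> C a \<longleftrightarrow> (\<forall>i. a + i \<in> L \<longrightarrow> x + i \<in> L)" for x a
    unfolding C_def by (auto simp flip: mem_decrement)
  show ?thesis
  proof (cases "f -` L = {}")
    case True
    have "\<Inter>?D = {}"
    proof -
      have "x \<notin> \<Inter>?D" for x
      proof
        assume "x \<in> \<Inter>?D"
        \<comment> \<open>The decrement by \<open>f x - x\<close> tests at \<open>x\<close> whether
          \<open>f x\<close> lies in \<open>L\<close>.\<close>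
        then have "x + (f x - x) \<in> L" by (simp add: mem_decrement)
        then show False using True le[of x] by auto
      qed
      then show ?thesis by blast
    qed
    then show ?thesis
      using lattice_over_Inter[OF lat fin _ D] True by simp
  next
    case False
    have "C a \<in> \<L>" if "f a \<in> L" for a
      unfolding C_def
    proof (rule lattice_over_Inter[OF lat])
      have "a \<in> decrement L (f a - a)" using that le[of a] by (simp add: mem_decrement)
      then show "{A \<in> ?D. a \<in> A} \<noteq> {}" by blast
    qed (use fin D in auto)
    \<comment> \<open>Even for infinitely many \<open>a\<close> only finitely many sets
      \<open>C a\<close> arise, each being the intersection of a subset of the finite
      \<open>?D\<close>.\<close>
    moreover have "finite (C ` (f -` L))"
    proof (rule finite_surj)
      show "finite (Pow ?D)" using fin by simp
      show "C ` (f -` L) \<subseteq> Inter ` Pow ?D" unfolding C_def by blast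
    qed
    ultimately have "\<Union>(C ` (f -` L)) \<in> \<L>"
      using False by (intro lattice_over_Union[OF lat]) auto
    moreover have "\<Union>(C ` (f -` L)) = f -` L"
    proof -
      have "f x \<in> L" if "x \<in> C a" "f a \<in> L" for x a
        using le incr _ that(2)
        by (rule vimage_mem_transfer) (use that(1) in \<open>simp add: mem_C\<close>)
      moreover have "x \<in> C x" for x by (simp add: mem_C)
      ultimately show ?thesis by blast
    qed
    ultimately show ?thesis by simp
  qed
qed

lemma power_add_eq_add_mult:
  fixes x d :: nat
  shows "\<exists>m. (x + d) ^ k = x ^ k + m * d"
proof (induction k)
  case (Suc k)
  then obtain m where "(x + d) ^ k = x ^ k + m * d" by blast
  \<comment> \<open>Expand \<open>(x + d) * (x ^ k + m * d)\<close> and collect the multiples of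
    \<open>d\<close>.\<close>
  then have "(x + d) ^ Suc k = x ^ Suc k + (x ^ k + (x + d) * m) * d"
    by (simp add: algebra_simps)
  then show ?case by blast
qed simp

theorem theorem2p2:
  fixes k :: nat and \<L> :: "nat set set"
  assumes "k \<noteq> 0"
    and "lattice_over (UNIV :: nat set) \<L>"
    and "\<And>L. L \<in> \<L> \<Longrightarrow> regular L"
    and "closed_under_decrement \<L>"
  shows "\<forall>L\<in>\<L>. kroot k L \<in> \<L>"
proof
  fix L assume "L \<in> \<L>"
  have "x \<le> x ^ k" for x :: nat
    \<comment> \<open>\<open>self_le_power\<close> requires a base of at least 1, hence the separate
      case 0.\<close>
    using assms(1) by (cases "x = 0") (auto intro: self_le_power)
  then have "(\<lambda>x. x ^ k) -` L \<in> \<L>"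
    using assms(2-4) \<open>L \<in> \<L>\<close> power_add_eq_add_mult by (intro lattice_closed_vimage) auto
  then show "kroot k L \<in> \<L>"
    by (simp add: kroot_def vimage_def)
qed

end
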